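(* Let $n_1,n_2,m_1,m_2$ be dimensions, let $X \subseteq \mathbb{R}^{n_1}$, and let $f:\mathbb{R}^{n_1}\to\mathbb{R}$, $g:\mathbb{R}^{n_1}\to\mathbb{R}^{m_1}$, $\theta:\mathbb{R}^{n_2}\to\mathbb{R}^{m_2}$, $h:\mathbb{R}^{n_1}\to\mathbb{R}^{n_2}$ be functions. Let $$F := \{(x,y)\in\mathbb{R}^{n_1}\times\mathbb{R}^{n_2} : x\in X,\ g(x)\le 0,\ \theta(y)\le 0,\ y=h(x)\},$$ and assume that $\min_{(x,y)\in F} f(x)$ is attained (its set of optimal solutions is nonempty); denote its optimal value by $v^*$. Let $$F^+ := \{(x,y,f(x)) : (x,y)\in F\}\subseteq \mathbb{R}^{n_1+n_2+1}.$$ Then $$v^* = \min\{\phi : (x,y,\phi)\in \operatorname{conv}(F^+)\}.$$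
   Context: Vector inequalities such as $g(x)\le 0$ are component-wise. $\operatorname{conv}(S)$ denotes the convex hull of $S$. In a triple $(x,y,\phi)\in\mathbb{R}^{n_1}\times\mathbb{R}^{n_2}\times\mathbb{R}$, $\phi$ is the scalar last coordinate. No convexity or continuity of $X,f,g,\theta,h$ is assumed. *)

theory Defs
  imports "HOL-Analysis.Analysis"
begin

text \<open>The order on \<^typ>\<open>real ^ 'm\<close> is the component-wise one, so \<open>g x \<le> 0\<close> and
  \<open>\<theta> y \<le> 0\<close> are systems of scalar inequalities.\<close>

definition feasible_set ::
  "(real ^ 'n1) set \<Rightarrow> (real ^ 'n1 \<Rightarrow> real ^ 'm1) \<Rightarrow> (real ^ 'n2 \<Rightarrow> real ^ 'm2) \<Rightarrow>
   (real ^ 'n1 \<Rightarrow> real ^ 'n2) \<Rightarrow> ((real ^ 'n1) \<times> (real ^ 'n2)) set" where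
  "feasible_set X g \<theta> h = {(x, y). x \<in> X \<and> g x \<le> 0 \<and> \<theta> y \<le> 0 \<and> y = h x}"

definition lifted_feasible_set ::
  "(real ^ 'n1) set \<Rightarrow> (real ^ 'n1 \<Rightarrow> real) \<Rightarrow> (real ^ 'n1 \<Rightarrow> real ^ 'm1) \<Rightarrow>
   (real ^ 'n2 \<Rightarrow> real ^ 'm2) \<Rightarrow> (real ^ 'n1 \<Rightarrow> real ^ 'n2) \<Rightarrow>
   ((real ^ 'n1) \<times> (real ^ 'n2) \<times> real) set" where
  "lifted_feasible_set X f g \<theta> h = {(x, y, f x) | x y. (x, y) \<in> feasible_set X g \<theta> h}"

text \<open>An attained minimum, in contrast to an infimum.\<close>

definition is_minimum :: "'a::order set \<Rightarrow> 'a \<Rightarrow> bool" where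
  "is_minimum S v \<longleftrightarrow> v \<in> S \<and> (\<forall>s\<in>S. v \<le> s)"

end

theory Submission
  imports Defs
begin

text \<open>The objective is linear in the lifted space: it is the last coordinate \<open>\<phi>\<close>. A lower
  bound for a linear functional on a set cuts out a half-space containing the set; half-spaces
  are convex, so the convex hull obeys the same bound. Hence convexification neither lowers the
  value below \<open>v_opt\<close> nor removes the lifted optimal point at which it is attained.\<close>

text \<open>The bound is stated on the last coordinate of a triple, which is the inner product with
  \<open>(0, 0, 1)\<close>.\<close>

lemma convex_hull_last_coordinate_ge:
  fixes S :: "('a::real_inner \<times> 'b::real_inner \<times> real) set"
  assumes bound: "\<And>x y \<phi>. (x, y, \<phi>) \<in> S \<Longrightarrow> v \<le> \<phi>"
    and mem: "(x, y, \<phi>) \<in> convex hull S"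
  shows "v \<le> \<phi>"
proof -
  let ?H = "{p :: 'a \<times> 'b \<times> real. inner (0, 0, 1) p \<ge> v}"
  have "S \<subseteq> ?H"
    using bound by (auto simp: inner_prod_def)
  then have "convex hull S \<subseteq> ?H"
    by (intro hull_minimal convex_halfspace_ge)
  then show ?thesis
    using mem by (auto simp: inner_prod_def)
qed

theorem proposition1:
  fixes X :: "(real ^ 'n1) set"
    and f :: "real ^ 'n1 \<Rightarrow> real"
    and g :: "real ^ 'n1 \<Rightarrow> real ^ 'm1"
    and \<theta> :: "real ^ 'n2 \<Rightarrow> real ^ 'm2"
    and h :: "real ^ 'n1 \<Rightarrow> real ^ 'n2"
    and x_opt :: "real ^ 'n1" and y_opt :: "real ^ 'n2" and v_opt :: real
  assumes "is_arg_min (\<lambda>(x, y). f x) (\<lambda>p. p \<in> feasible_set X g \<theta> h) (x_opt, y_opt)"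
    and "v_opt = f x_opt"
  shows "is_minimum
    {\<phi>. \<exists>x y. (x, y, \<phi>) \<in> convex hull (lifted_feasible_set X f g \<theta> h)} v_opt"
proof -
  let ?L = "lifted_feasible_set X f g \<theta> h"
  have feasible: "(x_opt, y_opt) \<in> feasible_set X g \<theta> h"
    and optimal: "\<And>x y. (x, y) \<in> feasible_set X g \<theta> h \<Longrightarrow> v_opt \<le> f x"
    using assms by (force simp: is_arg_min_linorder)+
  have "(x_opt, y_opt, v_opt) \<in> ?L"
    using feasible assms(2) by (auto simp: lifted_feasible_set_def)
  then have attained: "(x_opt, y_opt, v_opt) \<in> convex hull ?L"
    by (rule hull_inc)
  have "v_opt \<le> \<phi>" if "(x, y, \<phi>) \<in> ?L" for x y \<phi>
    using that optimal by (auto simp: lifted_feasible_set_def)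
  then have "v_opt \<le> \<phi>" if "(x, y, \<phi>) \<in> convex hull ?L" for x y \<phi>
    using that by (rule convex_hull_last_coordinate_ge)
  with attained show ?thesis
    by (auto simp: is_minimum_def)
qed

end
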